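(* For $n\geq 7$, the numbers $a_n(312;321)$ satisfy \[ a_n(312;321) = a_{n-1}(312;321)+a_{n-2}(312;321)+2a_{n-3}(312;321)+a_{n-4}(312;321), \] where $a_3(312;321)=1$, $a_4(312;321)=2$, $a_5(312;321)=5$, and $a_6(312;321)=10$. In closed form, for $n\geq 3$, \[ a_n(312;321) = \sum_{k=0}^{\lfloor (n-2)/2\rfloor}\ \sum_{j=0}^{n-2-2k}\binom{n-2-k-j}{k}\binom{2k}{j}. \]
   Context: $\mathcal{S}_n$ is the set of permutations of $[n]=\{1,\dots,n\}$, written in one-line notation $\pi=\pi_1\pi_2\cdots\pi_n$ with $\pi_i=\pi(i)$. A permutation is cyclic if it consists of exactly one $n$-cycle. For a cyclic $\pi$, its standard cycle notation is $C(\pi)=(c_1,c_2,\dots,c_n)$ with $c_1=1$ and $c_i=\pi_{c_{i-1}}$ for $2\le i\le n$. A sequence of distinct integers $w_1\cdots w_m$ contains a pattern $\sigma\in\mathcal{S}_k$ if there are indices $i_1<\dots<i_k$ with $w_{i_1}\cdots w_{i_k}$ in the same relative order as $\sigma_1\cdots\sigma_k$; otherwise it avoids $\sigma$. For $\sigma,\tau\in\mathcal{S}_3$, $\mathcal{A}_n(\sigma;\tau)$ is the set of cyclic permutations $\pi\in\mathcal{S}_n$ whose one-line notation avoids $\sigma$ and whose cycle notation $C(\pi)$ (as the sequence $c_1c_2\cdots c_n$) avoids $\tau$; $a_n(\sigma;\tau)=|\mathcal{A}_n(\sigma;\tau)|$. *)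

theory Defs
  imports "HOL-Combinatorics.Combinatorics"
begin

definition cyclic_perm :: "nat \<Rightarrow> (nat \<Rightarrow> nat) \<Rightarrow> bool" where
  "cyclic_perm n \<pi> \<longleftrightarrow> \<pi> permutes {1..n} \<and> cyclic_on \<pi> {1..n}"

definition one_line :: "nat \<Rightarrow> (nat \<Rightarrow> nat) \<Rightarrow> nat list" where
  "one_line n \<pi> = map \<pi> [1..<Suc n]"

text \<open>For cyclic \<open>\<pi>\<close> the iterates listed here are the sequence with \<open>c\<^sub>1 = 1\<close> and
  \<open>c\<^sub>i = \<pi> c\<^sub>i\<^sub>-\<^sub>1\<close>; list positions are counted from 0.\<close>

definition cycle_notation :: "nat \<Rightarrow> (nat \<Rightarrow> nat) \<Rightarrow> nat list" where
  "cycle_notation n \<pi> = map (\<lambda>i. (\<pi> ^^ i) 1) [0..<n]"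

text \<open>A pattern in \<open>S\<^sub>k\<close> is given by the list of its one-line notation. The function \<open>f\<close> is the
  choice of indices \<open>i\<^sub>1 < \<dots> < i\<^sub>k\<close>.\<close>

definition contains_pattern :: "nat list \<Rightarrow> nat list \<Rightarrow> bool" where
  "contains_pattern w \<sigma> \<longleftrightarrow>
     (\<exists>f. f ` {..<length \<sigma>} \<subseteq> {..<length w} \<and> strict_mono_on {..<length \<sigma>} f \<and>
        (\<forall>p<length \<sigma>. \<forall>q<length \<sigma>. w ! f p < w ! f q \<longleftrightarrow> \<sigma> ! p < \<sigma> ! q))"

definition avoids :: "nat list \<Rightarrow> nat list \<Rightarrow> bool" where
  "avoids w \<sigma> \<longleftrightarrow> \<not> contains_pattern w \<sigma>"

definition avoiders :: "nat \<Rightarrow> nat list \<Rightarrow> nat list \<Rightarrow> (nat \<Rightarrow> nat) set" where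
  "avoiders n \<sigma> \<tau> =
     {\<pi>. cyclic_perm n \<pi> \<and> avoids (one_line n \<pi>) \<sigma> \<and> avoids (cycle_notation n \<pi>) \<tau>}"

definition num_avoiders :: "nat \<Rightarrow> nat list \<Rightarrow> nat list \<Rightarrow> nat" where
  "num_avoiders n \<sigma> \<tau> = card (avoiders n \<sigma> \<tau>)"

end

theory Submission
  imports Defs "HOL-Computational_Algebra.Formal_Power_Series"
begin

text \<open>In an avoiding cycle of length \<open>n \<ge> 2\<close> the last entry is \<open>n\<close>, so only the edges
  \<open>c\<^sub>i \<rightarrow> c\<^sub>i\<^sub>+\<^sub>1\<close> matter for the one-line notation. For \<open>n \<ge> 3\<close> the second entry is 2, 3 or 4, and
  deleting the letters \<open>1..r\<close> for a suitable \<open>r \<le> 4\<close> leaves an avoiding cycle of length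
  \<open>n - r \<ge> 2\<close>. The deleted letters can be put back in one way for \<open>r = 1, 2, 4\<close> and in two ways for
  \<open>r = 3\<close>, all with different results, which gives the recurrence. Hence the generating function is
  \<open>x\<^sup>2 / (1 - x - x\<^sup>2 (1 + x)\<^sup>2)\<close>, and its geometric expansion
  \<open>\<Sum>k. x\<^sup>2 x\<^sup>2\<^sup>k (1 + x)\<^sup>2\<^sup>k / (1 - x)\<^sup>k\<^sup>+\<^sup>1\<close> gives the closed form.\<close>

subsection \<open>Cycle notation as a list of edges\<close>

text \<open>Recursive, so that statements about a list with something put in front follow by
  induction: each entry is tested as the largest letter of a 321 pattern.\<close>

fun avoids321 :: "nat list \<Rightarrow> bool" where
  "avoids321 [] \<longleftrightarrow> True"
| "avoids321 (x # xs) \<longleftrightarrow> sorted_wrt (\<lambda>y z. \<not> (z < y \<and> y < x)) xs \<and> avoids321 xs"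

text \<open>The edge from the last entry back to \<open>1\<close> is left out. This is harmless: the last entry of
  the cycles in question is \<open>n\<close>, and \<open>\<pi> n = 1\<close> cannot be part of a 312 pattern.\<close>

definition edges :: "nat list \<Rightarrow> (nat \<times> nat) set" where
  "edges xs = set (zip xs (tl xs))"

definition no312 :: "(nat \<times> nat) set \<Rightarrow> bool" where
  "no312 E \<longleftrightarrow> (\<forall>x y z x' y' z'. (x, x') \<in> E \<longrightarrow> (y, y') \<in> E \<longrightarrow> (z, z') \<in> E \<longrightarrow>
     x < y \<longrightarrow> y < z \<longrightarrow> \<not> (y' < z' \<and> z' < x'))"

text \<open>The condition \<open>2 \<le> n\<close> makes the set empty for \<open>n < 2\<close>, so
  the recurrence below also holds where its subtractions are truncated.\<close>

definition cycle_lists :: "nat \<Rightarrow> nat list set" where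
  "cycle_lists n = {C. 2 \<le> n \<and> distinct C \<and> set C = {1..n} \<and> hd C = 1 \<and> last C = n \<and>
     avoids321 C \<and> no312 (edges C)}"

section \<open>Pattern avoidance as inequalities between entries\<close>

lemma avoids321_iff_nth:
  "avoids321 xs \<longleftrightarrow> (\<forall>i j l. i < j \<longrightarrow> j < l \<longrightarrow> l < length xs \<longrightarrow> \<not> (xs ! l < xs ! j \<and> xs ! j < xs ! i))"
proof (induction xs)
  case (Cons x xs)
  have "(\<forall>i j l. i < j \<longrightarrow> j < l \<longrightarrow> l < length (x # xs) \<longrightarrow>
          \<not> ((x # xs) ! l < (x # xs) ! j \<and> (x # xs) ! j < (x # xs) ! i)) \<longleftrightarrow>
        (\<forall>j l. j < l \<longrightarrow> l < length xs \<longrightarrow> \<not> (xs ! l < xs ! j \<and> xs ! j < x)) \<and>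
        (\<forall>i j l. i < j \<longrightarrow> j < l \<longrightarrow> l < length xs \<longrightarrow> \<not> (xs ! l < xs ! j \<and> xs ! j < xs ! i))"
    (is "(\<forall>i j l. ?P i j l) \<longleftrightarrow> ?Q \<and> ?R")
  proof (intro iffI conjI allI impI)
    fix j l assume *: "\<forall>i j l. ?P i j l" and "j < l" "l < length xs"
    then show "\<not> (xs ! l < xs ! j \<and> xs ! j < x)"
      using *[rule_format, of 0 "Suc j" "Suc l"] by simp
  next
    fix i j l assume *: "\<forall>i j l. ?P i j l" and "i < j" "j < l" "l < length xs"
    then show "\<not> (xs ! l < xs ! j \<and> xs ! j < xs ! i)"
      using *[rule_format, of "Suc i" "Suc j" "Suc l"] by simp
  next
    fix i j l assume *: "?Q \<and> ?R" "i < j" "j < l" "l < length (x # xs)"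
    then obtain j' l' where "j = Suc j'" "l = Suc l'"
      by (metis Suc_pred less_nat_zero_code neq0_conv)
    then show "\<not> ((x # xs) ! l < (x # xs) ! j \<and> (x # xs) ! j < (x # xs) ! i)"
      using * by (cases i) auto
  qed
  then show ?case using Cons by (simp only: avoids321.simps sorted_wrt_iff_nth_less)
qed simp

lemma edges_iff_nth: "(x, y) \<in> edges xs \<longleftrightarrow> (\<exists>i. Suc i < length xs \<and> x = xs ! i \<and> y = xs ! Suc i)"
  unfolding edges_def set_zip by (auto simp: nth_tl less_diff_conv)

text \<open>The choice function \<open>f\<close> becomes three explicit indices. All six ordered
  comparisons are kept because entries of \<open>w\<close> may coincide here.\<close>

lemma contains_pattern_3:
  "contains_pattern w [a, b, c] \<longleftrightarrow>
     (\<exists>i j l. i < j \<and> j < l \<and> l < length w \<and>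
       (w ! i < w ! j \<longleftrightarrow> a < b) \<and> (w ! i < w ! l \<longleftrightarrow> a < c) \<and> (w ! j < w ! i \<longleftrightarrow> b < a) \<and>
       (w ! j < w ! l \<longleftrightarrow> b < c) \<and> (w ! l < w ! i \<longleftrightarrow> c < a) \<and> (w ! l < w ! j \<longleftrightarrow> c < b))"
    (is "?L \<longleftrightarrow> ?R")
proof
  assume ?L
  then obtain f where f: "f ` {..<3} \<subseteq> {..<length w}" "strict_mono_on {..<3} f"
    "\<forall>p<3. \<forall>q<3. w ! f p < w ! f q \<longleftrightarrow> [a, b, c] ! p < [a, b, c] ! q"
    by (auto simp: contains_pattern_def numeral_3_eq_3)
  have "f 0 < f 1" "f 1 < f 2"
    using f(2) by (auto simp: strict_mono_on_def)
  moreover have "f 2 < length w"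
    using f(1) by (auto dest: subsetD[of _ _ "f 2"])
  moreover have "w ! f p < w ! f q \<longleftrightarrow> [a, b, c] ! p < [a, b, c] ! q" if "p < 3" "q < 3" for p q
    using f(3) that by blast
  from this[of 0 1] this[of 0 2] this[of 1 0] this[of 1 2] this[of 2 0] this[of 2 1]
  have "(w ! f 0 < w ! f 1 \<longleftrightarrow> a < b) \<and> (w ! f 0 < w ! f 2 \<longleftrightarrow> a < c) \<and>
    (w ! f 1 < w ! f 0 \<longleftrightarrow> b < a) \<and> (w ! f 1 < w ! f 2 \<longleftrightarrow> b < c) \<and>
    (w ! f 2 < w ! f 0 \<longleftrightarrow> c < a) \<and> (w ! f 2 < w ! f 1 \<longleftrightarrow> c < b)"
    by simp
  ultimately show ?R by blast
next
  assume ?R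
  then obtain i j l where *: "i < j" "j < l" "l < length w"
    "w ! i < w ! j \<longleftrightarrow> a < b" "w ! i < w ! l \<longleftrightarrow> a < c" "w ! j < w ! i \<longleftrightarrow> b < a"
    "w ! j < w ! l \<longleftrightarrow> b < c" "w ! l < w ! i \<longleftrightarrow> c < a" "w ! l < w ! j \<longleftrightarrow> c < b"
    by blast
  have three: "{..<length [a, b, c]} = {0, 1, 2}" by auto
  have less3: "(\<forall>p<length [a, b, c]. P p) \<longleftrightarrow> P 0 \<and> P 1 \<and> P 2" for P
    by (auto simp: less_Suc_eq numeral_2_eq_2)
  show ?L
    unfolding contains_pattern_def three less3
  proof (intro exI conjI)
    show "(\<lambda>p. [i, j, l] ! p) ` {0, 1, 2} \<subseteq> {..<length w}"
      using * by simp
    show "strict_mono_on {0, 1, 2} (\<lambda>p. [i, j, l] ! p)"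
      by (rule strict_mono_onI) (elim insertE; use * in simp)
  qed (use * in simp_all)
qed

lemma avoids_321_iff:
  "avoids w [3, 2, 1] \<longleftrightarrow> avoids321 w"
proof -
  have "contains_pattern w [3, 2, 1] \<longleftrightarrow>
    (\<exists>i j l. i < j \<and> j < l \<and> l < length w \<and> w ! l < w ! j \<and> w ! j < w ! i)"
  proof -
    have "((x < y) = ((3::nat) < 2) \<and> (x < z) = ((3::nat) < 1) \<and> (y < x) = ((2::nat) < 3) \<and>
        (y < z) = ((2::nat) < 1) \<and> (z < x) = ((1::nat) < 3) \<and> (z < y) = ((1::nat) < 2)) \<longleftrightarrow>
        z < y \<and> y < x" for x y z :: nat
      by auto
    then show ?thesis by (simp only: contains_pattern_3)
  qed
  then show ?thesis by (auto simp: avoids_def avoids321_iff_nth)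
qed

lemma avoids_312_iff:
  "avoids (one_line n \<pi>) [3, 1, 2] \<longleftrightarrow>
    (\<forall>i j l. 1 \<le> i \<longrightarrow> i < j \<longrightarrow> j < l \<longrightarrow> l \<le> n \<longrightarrow> \<not> (\<pi> j < \<pi> l \<and> \<pi> l < \<pi> i))"
    (is "_ \<longleftrightarrow> (\<forall>i j l. ?P i j l)")
proof -
  have len: "length (one_line n \<pi>) = n"
    by (simp add: one_line_def)
  have nth: "one_line n \<pi> ! i = \<pi> (Suc i)" if "i < n" for i
    using that by (simp add: one_line_def del: upt_Suc)
  have "avoids (one_line n \<pi>) [3, 1, 2] \<longleftrightarrow>
    (\<forall>i j l. i < j \<longrightarrow> j < l \<longrightarrow> l < n \<longrightarrow> \<not> (\<pi> (Suc j) < \<pi> (Suc l) \<and> \<pi> (Suc l) < \<pi> (Suc i)))"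
    (is "_ \<longleftrightarrow> ?R")
  proof -
    have "contains_pattern (one_line n \<pi>) [3, 1, 2] \<longleftrightarrow>
      (\<exists>i j l. i < j \<and> j < l \<and> l < n \<and> \<pi> (Suc j) < \<pi> (Suc l) \<and> \<pi> (Suc l) < \<pi> (Suc i))"
    proof -
      have "((x < y) = ((3::nat) < 1) \<and> (x < z) = ((3::nat) < 2) \<and> (y < x) = ((1::nat) < 3) \<and>
          (y < z) = ((1::nat) < 2) \<and> (z < x) = ((2::nat) < 3) \<and> (z < y) = ((2::nat) < 1)) \<longleftrightarrow>
          y < z \<and> z < x" for x y z :: nat
        by auto
      then show ?thesis
        by (simp only: contains_pattern_3 len) (simp add: nth cong: conj_cong)
    qed
    then show ?thesis by (auto simp: avoids_def)
  qed
  also have "?R \<longleftrightarrow> (\<forall>i j l. ?P i j l)"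
  proof (intro iffI allI impI)
    fix i j l assume R: ?R and *: "1 \<le> i" "i < j" "j < l" "l \<le> n"
    obtain i' j' l' where "i = Suc i'" "j = Suc j'" "l = Suc l'"
      using * by (metis Suc_le_D less_imp_Suc_add One_nat_def)
    then show "\<not> (\<pi> j < \<pi> l \<and> \<pi> l < \<pi> i)" using R * by auto
  next
    fix i j l assume R: "\<forall>i j l. ?P i j l" and "i < j" "j < l" "l < n"
    then show "\<not> (\<pi> (Suc j) < \<pi> (Suc l) \<and> \<pi> (Suc l) < \<pi> (Suc i))"
      using R[rule_format, of "Suc i" "Suc j" "Suc l"] by simp
  qed
  finally show ?thesis .
qed

section \<open>Cycle notation of a cyclic permutation\<close>

lemma cyclic_perm_funpow_n:
  assumes "cyclic_perm n \<pi>" "n \<ge> 1"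
  shows "(\<pi> ^^ n) 1 = 1" and "set (cycle_notation n \<pi>) = {1..n}"
proof -
  let ?d = "funpow_dist1 \<pi> 1 1"
  have orb: "orbit \<pi> 1 = {1..n}"
    using assms unfolding cyclic_perm_def by (intro orbit_cyclic_eq3) auto
  then have in_orb: "1 \<in> orbit \<pi> 1" using assms by simp
  have img: "orbit \<pi> 1 = (\<lambda>i. (\<pi> ^^ i) 1) ` {0..<?d}"
    by (rule orbit_conv_funpow_dist1[OF in_orb])
  moreover have "inj_on (\<lambda>i. (\<pi> ^^ i) 1) {0..<?d}"
    by (rule inj_on_funpow_dist1[OF in_orb])
  \<comment> \<open>The first return time to 1 is the size of the orbit of 1, which is all of
    \<open>{1..n}\<close>.\<close>
  ultimately have "card {1..n} = ?d" using orb by (metis card_atLeastLessThan card_image minus_nat.diff_0)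
  then have d: "?d = n" by simp
  show "(\<pi> ^^ n) 1 = 1" using funpow_dist1_prop[OF in_orb] unfolding d .
  show "set (cycle_notation n \<pi>) = {1..n}" using img orb d by (simp add: cycle_notation_def)
qed

lemma length_cycle_notation: "length (cycle_notation n \<pi>) = n"
  by (simp add: cycle_notation_def)

lemma nth_cycle_notation: "i < n \<Longrightarrow> cycle_notation n \<pi> ! i = (\<pi> ^^ i) 1"
  by (simp add: cycle_notation_def)

lemma distinct_cycle_notation:
  assumes "cyclic_perm n \<pi>" "n \<ge> 1"
  shows "distinct (cycle_notation n \<pi>)"
  using cyclic_perm_funpow_n(2)[OF assms] by (intro card_distinct) (simp add: length_cycle_notation)

lemma hd_cycle_notation: "n \<ge> 1 \<Longrightarrow> hd (cycle_notation n \<pi>) = 1"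
  by (simp add: cycle_notation_def hd_map)

lemma last_cycle_notation: "n \<ge> 1 \<Longrightarrow> last (cycle_notation n \<pi>) = (\<pi> ^^ (n - 1)) 1"
  by (cases n) (simp_all add: cycle_notation_def last_map)

lemma apply_last_cycle_notation:
  assumes "cyclic_perm n \<pi>" "n \<ge> 1"
  shows "\<pi> (last (cycle_notation n \<pi>)) = 1"
proof -
  have "\<pi> ((\<pi> ^^ (n - 1)) 1) = (\<pi> ^^ n) 1"
    using assms(2) by (cases n) simp_all
  then show ?thesis
    using cyclic_perm_funpow_n(1)[OF assms] last_cycle_notation[OF assms(2)] by simp
qed

lemma edges_cycle_notation:
  assumes "cyclic_perm n \<pi>" "n \<ge> 1"
  shows "edges (cycle_notation n \<pi>) =
    {(x, \<pi> x) |x. x \<in> {1..n} \<and> x \<noteq> last (cycle_notation n \<pi>)}"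
proof (intro set_eqI iffI)
  let ?C = "cycle_notation n \<pi>"
  have ne: "?C \<noteq> []" using assms(2) length_cycle_notation[of n \<pi>] by auto
  have last: "last ?C = ?C ! (n - 1)" using ne by (simp add: last_conv_nth length_cycle_notation)
  have Suc: "?C ! Suc i = \<pi> (?C ! i)" if "Suc i < n" for i
    using that by (simp add: nth_cycle_notation)
  fix e
  {
    assume "e \<in> edges ?C"
    then obtain i where i: "Suc i < n" "e = (?C ! i, ?C ! Suc i)"
      by (cases e) (auto simp: edges_iff_nth length_cycle_notation)
    then have "?C ! i \<in> {1..n}"
      using cyclic_perm_funpow_n(2)[OF assms] nth_mem[of i ?C] by (simp add: length_cycle_notation)
    moreover have "?C ! i \<noteq> ?C ! (n - 1)"
      using i nth_eq_iff_index_eq[OF distinct_cycle_notation[OF assms], of i "n - 1"]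
      by (simp add: length_cycle_notation)
    moreover have "e = (?C ! i, \<pi> (?C ! i))" using i(2) Suc[OF i(1)] by simp
    ultimately show "e \<in> {(x, \<pi> x) |x. x \<in> {1..n} \<and> x \<noteq> last ?C}"
      by (simp add: last)
  next
    assume "e \<in> {(x, \<pi> x) |x. x \<in> {1..n} \<and> x \<noteq> last ?C}"
    then obtain x where x: "e = (x, \<pi> x)" "x \<in> {1..n}" "x \<noteq> last ?C"
      by auto
    then obtain i where i: "i < n" "?C ! i = x"
      unfolding cyclic_perm_funpow_n(2)[OF assms, symmetric] in_set_conv_nth length_cycle_notation
      by auto
    have "i \<noteq> n - 1"
      using x(3) i(2) last by auto
    then have "Suc i < n" using i(1) by simp
    then have "Suc i < length ?C \<and> x = ?C ! i \<and> \<pi> x = ?C ! Suc i"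
      using i(2) Suc by (simp add: length_cycle_notation)
    then show "e \<in> edges ?C"
      unfolding x(1) edges_iff_nth by (rule exI)
  }
qed

text \<open>If \<open>\<pi> m = 1\<close> then avoiding 312 forces every value at a position beyond \<open>m\<close> to exceed every
  value at a position up to \<open>m\<close>, so \<open>{1..m}\<close> is invariant, which for cyclic \<open>\<pi>\<close> means \<open>m = n\<close>.\<close>

lemma last_cycle_notation_312:
  assumes "cyclic_perm n \<pi>" "n \<ge> 1" "avoids (one_line n \<pi>) [3, 1, 2]"
  shows "last (cycle_notation n \<pi>) = n"
proof (rule ccontr)
  define m where "m = last (cycle_notation n \<pi>)"
  assume "last (cycle_notation n \<pi>) \<noteq> n"
  have per: "\<pi> permutes {1..n}" using assms(1) by (simp add: cyclic_perm_def)
  have "cycle_notation n \<pi> \<noteq> []" using assms(2) length_cycle_notation[of n \<pi>] by auto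
  then have "m \<in> {1..n}"
    unfolding m_def using cyclic_perm_funpow_n(2)[OF assms(1,2)] last_in_set by metis
  then have m: "1 \<le> m" "m < n" using \<open>last (cycle_notation n \<pi>) \<noteq> n\<close> by (auto simp: m_def)
  have pm: "\<pi> m = 1" using apply_last_cycle_notation[OF assms(1,2)] by (simp add: m_def)
  have less: "\<pi> i < \<pi> j" if "1 \<le> i" "i \<le> m" "m < j" "j \<le> n" for i j
  proof -
    have "\<pi> j \<in> {1..n}" using that permutes_in_image[OF per, of j] by simp
    moreover have "\<pi> j \<noteq> \<pi> m" "\<pi> i \<noteq> \<pi> j" using that by (simp_all add: inj_eq[OF permutes_inj[OF per]])
    ultimately show ?thesis
      using assms(3)[unfolded avoids_312_iff, rule_format, of i m j] that pm
      by (cases "i = m") auto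
  qed
  have inv: "\<pi> i \<le> m" if "1 \<le> i" "i \<le> m" for i
  proof (rule ccontr)
    assume "\<not> \<pi> i \<le> m"
    \<comment> \<open>The positions beyond \<open>m\<close> are then mapped into themselves, hence
      bijectively by finiteness, so the value \<open>\<pi> i > m\<close> would be attained
      twice.\<close>
    have "\<pi> j \<in> {m<..n}" if "j \<in> {m<..n}" for j
      using less[OF \<open>1 \<le> i\<close> \<open>i \<le> m\<close>, of j] \<open>\<not> \<pi> i \<le> m\<close> permutes_in_image[OF per, of j] that m
      by simp
    then have "\<pi> ` {m<..n} \<subseteq> {m<..n}" by blast
    moreover have "inj_on \<pi> {m<..n}" using permutes_inj[OF per] by (rule inj_on_subset) simp
    ultimately have "\<pi> ` {m<..n} = {m<..n}" by (intro endo_inj_surj) auto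
    moreover have "\<pi> i \<in> {m<..n}"
      using \<open>\<not> \<pi> i \<le> m\<close> that m permutes_in_image[OF per, of i] by auto
    ultimately obtain j where "j \<in> {m<..n}" "\<pi> i = \<pi> j" by (metis imageE)
    then show False using that by (simp add: inj_eq[OF permutes_inj[OF per]])
  qed
  have "(\<pi> ^^ i) 1 \<in> {1..m}" for i
  proof (induction i)
    case (Suc i)
    moreover have "\<pi> x \<ge> 1" if "x \<in> {1..m}" for x
      using permutes_in_image[OF per, of x] that m by auto
    ultimately show ?case using inv by auto
  qed (use m in auto)
  then have "set (cycle_notation n \<pi>) \<subseteq> {1..m}" by (auto simp: cycle_notation_def)
  then show False using cyclic_perm_funpow_n(2)[OF assms(1,2)] m by auto
qed

lemma no312_cycle_notation:
  assumes "cyclic_perm n \<pi>" "n \<ge> 1" "last (cycle_notation n \<pi>) = n"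
  shows "no312 (edges (cycle_notation n \<pi>)) \<longleftrightarrow> avoids (one_line n \<pi>) [3, 1, 2]"
proof -
  have "\<pi> n = 1" using apply_last_cycle_notation[OF assms(1,2)] assms(3) by simp
  moreover have "\<pi> j \<ge> 1" if "j \<in> {1..n}" for j
    using permutes_in_image[of \<pi> "{1..n}" j] that assms(1) by (simp add: cyclic_perm_def)
  ultimately have *: "l \<noteq> n" if "1 \<le> j" "j < l" "l \<le> n" "\<pi> j < \<pi> l" for j l
    using that by force
  have "no312 (edges (cycle_notation n \<pi>)) \<longleftrightarrow>
    (\<forall>i j l. 1 \<le> i \<longrightarrow> i < j \<longrightarrow> j < l \<longrightarrow> l < n \<longrightarrow> \<not> (\<pi> j < \<pi> l \<and> \<pi> l < \<pi> i))"
    (is "?L \<longleftrightarrow> ?R")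
  proof
    assume ?L
    have "\<not> (\<pi> j < \<pi> l \<and> \<pi> l < \<pi> i)" if "1 \<le> i" "i < j" "j < l" "l < n" for i j l
      using that \<open>?L\<close>[unfolded no312_def edges_cycle_notation[OF assms(1,2)] assms(3),
          rule_format, of i "\<pi> i" j "\<pi> j" l "\<pi> l"] by simp
    then show ?R by blast
  next
    assume ?R
    then show ?L
      unfolding no312_def edges_cycle_notation[OF assms(1,2)] assms(3) by auto
  qed
  also have "\<dots> \<longleftrightarrow> avoids (one_line n \<pi>) [3, 1, 2]"
  proof
    assume L: "\<forall>i j l. 1 \<le> i \<longrightarrow> i < j \<longrightarrow> j < l \<longrightarrow> l < n \<longrightarrow> \<not> (\<pi> j < \<pi> l \<and> \<pi> l < \<pi> i)"
    have "\<not> (\<pi> j < \<pi> l \<and> \<pi> l < \<pi> i)" if "1 \<le> i" "i < j" "j < l" "l \<le> n" for i j l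
      using L[rule_format, of i j l] *[of j l] that by linarith
    then show "avoids (one_line n \<pi>) [3, 1, 2]" unfolding avoids_312_iff by blast
  next
    assume "avoids (one_line n \<pi>) [3, 1, 2]"
    then show "\<forall>i j l. 1 \<le> i \<longrightarrow> i < j \<longrightarrow> j < l \<longrightarrow> l < n \<longrightarrow> \<not> (\<pi> j < \<pi> l \<and> \<pi> l < \<pi> i)"
      unfolding avoids_312_iff by (blast intro: less_imp_le)
  qed
  finally show ?thesis .
qed

section \<open>Bijection between avoiding permutations and lists\<close>

lemma cyclic_perm_cycle_of_list:
  assumes "distinct C" "set C = {1..n}" "hd C = 1" "n \<ge> 1"
  shows "cyclic_perm n (cycle_of_list C)" and "cycle_notation n (cycle_of_list C) = C"
proof -
  let ?p = "cycle_of_list C"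
  have len: "length C = n" using assms(1,2) by (metis card_atLeastAtMost diff_Suc_1 distinct_card)
  have ne: "C \<noteq> []" using assms by auto
  have hd: "C ! 0 = 1" using assms(3) ne by (simp add: hd_conv_nth)
  have pow: "(?p ^^ i) 1 = C ! i" if "i < n" for i
  proof -
    \<comment> \<open>Applying the \<open>i\<close>-th power of the cycle to every entry rotates the
      list by \<open>i\<close> places.\<close>
    have "(?p ^^ i) (C ! 0) = map (?p ^^ i) C ! 0" using ne by simp
    also have "\<dots> = C ! i"
      using that len ne by (simp add: cyclic_rotation[OF assms(1)] nth_rotate)
    finally show ?thesis using hd by simp
  qed
  then show "cycle_notation n ?p = C"
    by (intro nth_equalityI) (simp_all add: length_cycle_notation nth_cycle_notation len)
  have per: "?p permutes {1..n}" using cycle_permutes[of C] assms(2) by simp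
  \<comment> \<open>An orbit consists of positive iterates, so 1 belongs to its own orbit only
    through a full turn.\<close>
  have "(?p ^^ n) 1 = 1" using cycle_is_id_root[OF assms(1)] len by simp
  then have one: "1 \<in> orbit ?p 1" using assms(4) by (auto simp: orbit_altdef intro!: exI[of _ n])
  have "x \<in> orbit ?p 1" if x: "x \<in> {1..n}" for x
  proof -
    obtain i where "i < n" "x = C ! i" using x assms(2) len by (metis in_set_conv_nth)
    then have "x = (?p ^^ i) 1" using pow by simp
    then show ?thesis
      using one by (cases i) (simp, force simp only: orbit_altdef)
  qed
  moreover have "orbit ?p 1 \<subseteq> {1..n}"
    using permutes_orbit_subset[OF per] assms(4) by auto
  ultimately show "cyclic_perm n ?p"
    using per assms(4) unfolding cyclic_perm_def cyclic_on_def by (auto intro!: bexI[of _ 1])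
qed

text \<open>The list determines \<open>\<pi>\<close> everywhere: points outside
  \<open>{1..n}\<close> are fixed, the last entry goes to 1, and every other value is read off an
  edge.\<close>

lemma inj_on_cycle_notation:
  assumes "n \<ge> 1"
  shows "inj_on (cycle_notation n) {\<pi>. cyclic_perm n \<pi>}"
proof (rule inj_onI)
  fix \<pi> \<rho>
  assume "\<pi> \<in> {\<pi>. cyclic_perm n \<pi>}" "\<rho> \<in> {\<pi>. cyclic_perm n \<pi>}"
    and eq: "cycle_notation n \<pi> = cycle_notation n \<rho>"
  then have cyc: "cyclic_perm n \<pi>" "cyclic_perm n \<rho>" by auto
  show "\<pi> = \<rho>"
  proof
    fix x
    consider "x \<notin> {1..n}" | "x = last (cycle_notation n \<pi>)"
      | "x \<in> {1..n}" "x \<noteq> last (cycle_notation n \<pi>)" by blast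
    then show "\<pi> x = \<rho> x"
    proof cases
      case 1
      then show ?thesis using cyc permutes_not_in[of _ "{1..n}" x] unfolding cyclic_perm_def by metis
    next
      case 2
      then show ?thesis using apply_last_cycle_notation[OF _ assms] cyc eq by metis
    next
      case 3
      then have "(x, \<pi> x) \<in> edges (cycle_notation n \<rho>)"
        using edges_cycle_notation[OF cyc(1) assms] eq by auto
      then show ?thesis by (simp add: edges_cycle_notation[OF cyc(2) assms])
    qed
  qed
qed

lemma num_avoiders_eq_card_cycle_lists:
  assumes "n \<ge> 2"
  shows "num_avoiders n [3, 1, 2] [3, 2, 1] = card (cycle_lists n)"
proof -
  have n: "n \<ge> 1" using assms by simp
  have "cycle_notation n ` avoiders n [3, 1, 2] [3, 2, 1] = cycle_lists n"
  proof (intro set_eqI iffI)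
    fix C assume "C \<in> cycle_notation n ` avoiders n [3, 1, 2] [3, 2, 1]"
    then obtain \<pi> where "C = cycle_notation n \<pi>" "cyclic_perm n \<pi>"
      "avoids (one_line n \<pi>) [3, 1, 2]" "avoids321 C"
      by (auto simp only: avoiders_def avoids_321_iff)
    then show "C \<in> cycle_lists n"
      using assms n by (simp add: cycle_lists_def distinct_cycle_notation cyclic_perm_funpow_n
          hd_cycle_notation last_cycle_notation_312 no312_cycle_notation)
  next
    fix C assume "C \<in> cycle_lists n"
    then have C: "distinct C" "set C = {1..n}" "hd C = 1" "last C = n" "avoids321 C" "no312 (edges C)"
      by (auto simp: cycle_lists_def)
    note cyc = cyclic_perm_cycle_of_list[OF C(1-3) n]
    have "cycle_of_list C \<in> avoiders n [3, 1, 2] [3, 2, 1]"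
      using C(4-6) no312_cycle_notation[OF cyc(1) n] cyc
      by (simp only: avoiders_def avoids_321_iff mem_Collect_eq)
    then show "C \<in> cycle_notation n ` avoiders n [3, 1, 2] [3, 2, 1]"
      by (rule rev_image_eqI) (simp only: cyc(2))
  qed
  moreover have "card (cycle_notation n ` avoiders n [3, 1, 2] [3, 2, 1]) =
      card (avoiders n [3, 1, 2] [3, 2, 1])"
    by (intro card_image inj_on_subset[OF inj_on_cycle_notation[OF n]]) (auto simp: avoiders_def)
  ultimately show ?thesis by (simp only: num_avoiders_def)
qed

subsection \<open>Front blocks\<close>

lemma edges_Nil [simp]: "edges [] = {}"
  by (simp add: edges_def)

lemma edges_single [simp]: "edges [x] = {}"
  by (simp add: edges_def)

lemma edges_Cons_Cons [simp]: "edges (x # y # zs) = insert (x, y) (edges (y # zs))"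
  by (simp add: edges_def)

lemma edges_append:
  "xs \<noteq> [] \<Longrightarrow> ys \<noteq> [] \<Longrightarrow> edges (xs @ ys) = insert (last xs, hd ys) (edges xs \<union> edges ys)"
proof (induction xs)
  case (Cons x xs)
  then show ?case by (cases xs; cases ys) auto
qed simp

text \<open>The edges starting in \<open>xs\<close> depend on \<open>ys\<close> only through its
  head, which separates the edges of an inserted front from those behind it.\<close>

lemma edges_append_hd: "ys \<noteq> [] \<Longrightarrow> edges (xs @ ys) = edges (xs @ [hd ys]) \<union> edges ys"
  by (cases "xs = []") (auto simp: edges_append)

lemma edges_map: "edges (map f xs) = map_prod f f ` edges xs"
  by (simp add: edges_def zip_map_map map_tl[symmetric] map_prod_def)

lemma edges_mem: "(x, y) \<in> edges xs \<Longrightarrow> x \<in> set xs \<and> y \<in> set (tl xs)"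
  unfolding edges_def by (blast dest: set_zip_leftD set_zip_rightD)

lemma avoids321_appendD: "avoids321 (xs @ ys) \<Longrightarrow> avoids321 ys"
  by (induction xs) auto

lemma avoids321D:
  assumes "avoids321 (xs @ ys @ zs)" "x \<in> set xs" "y \<in> set ys" "z \<in> set zs"
  shows "\<not> (z < y \<and> y < x)"
  using assms by (induction xs) (auto simp: sorted_wrt_append)

text \<open>A descent in \<open>xs\<close> followed by the smaller letter \<open>y\<close> would be
  a 321 pattern.\<close>

lemma avoids321_imp_sorted_prefix:
  assumes "avoids321 (xs @ y # ys)" "\<And>x. x \<in> set xs \<Longrightarrow> y < x"
  shows "sorted xs"
  using assms
proof (induction xs)
  case (Cons x xs)
  have "\<not> (y < z \<and> z < x)" if "z \<in> set xs" for z
    using Cons.prems(1) that by (simp add: sorted_wrt_append)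
  then have "x \<le> z" if "z \<in> set xs" for z
    using Cons.prems(2) that by (meson list.set_intros(2) not_le)
  then show ?case using Cons by simp
qed simp

text \<open>A decreasing triple meets a sorted prefix in at most one letter, which is then its first
  and largest.\<close>

lemma avoids321_sorted_append:
  assumes "sorted xs"
  shows "avoids321 (xs @ ys) \<longleftrightarrow>
    avoids321 ys \<and> (\<forall>x\<in>set xs. sorted_wrt (\<lambda>y z. \<not> (z < y \<and> y < x)) ys)"
  using assms
proof (induction xs)
  case (Cons x xs)
  have "sorted_wrt (\<lambda>y z. \<not> (z < y \<and> y < x)) xs"
    by (rule sorted_wrt_mono_rel[of _ "(\<le>)"]) (use Cons.prems in auto)
  moreover have "\<forall>y\<in>set xs. \<forall>z\<in>set ys. \<not> (z < y \<and> y < x)"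
    using Cons.prems by (simp add: not_less)
  ultimately have "sorted_wrt (\<lambda>y z. \<not> (z < y \<and> y < x)) (xs @ ys) \<longleftrightarrow>
      sorted_wrt (\<lambda>y z. \<not> (z < y \<and> y < x)) ys"
    unfolding sorted_wrt_append by blast
  moreover have "sorted xs" using Cons.prems by simp
  ultimately show ?case using Cons.IH by (simp only: append_Cons avoids321.simps list.set ball_simps) blast
qed simp

lemma avoids321_map_add: "avoids321 (map (\<lambda>x. x + r) xs) \<longleftrightarrow> avoids321 xs"
  by (induction xs) (simp_all add: sorted_wrt_map)

text \<open>\<open>S\<close> will be the inserted edges and \<open>L\<close> the old ones, with
  \<open>h\<close> as the new target of the edge that led to 2. A pattern starting in
  \<open>L\<close> stays in \<open>L\<close>. If it starts in \<open>S\<close>, its values are at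
  most \<open>r + 2\<close>; a third edge in \<open>L\<close> would have value \<open>h\<close>,
  with no smaller value left for the second edge, so the third edge is in \<open>S\<close>, and
  hence so is the second.\<close>

lemma no312_Un_low:
  assumes S: "no312 S" "\<And>x x'. (x, x') \<in> S \<Longrightarrow> x \<le> r \<and> x' \<le> r + 2 \<and> (h \<le> x' \<or> h = r + 2)"
    and L: "\<And>x x'. (x, x') \<in> L \<Longrightarrow> r < x \<and> (x' = h \<or> r + 2 < x')"
  shows "no312 (S \<union> L) \<longleftrightarrow> no312 L"
proof
  assume "no312 (S \<union> L)"
  then show "no312 L" unfolding no312_def by blast
next
  assume nL: "no312 L"
  show "no312 (S \<union> L)"
    unfolding no312_def
  proof (intro allI impI notI)
    fix x y z x' y' z'
    assume e: "(x, x') \<in> S \<union> L" "(y, y') \<in> S \<union> L" "(z, z') \<in> S \<union> L"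
      and xyz: "x < y" "y < z" and v: "y' < z' \<and> z' < x'"
    show False
    proof (cases "(x, x') \<in> L")
      case True
      then have "(y, y') \<in> L" "(z, z') \<in> L" using e(2,3) S(2) L xyz by fastforce+
      then show False using nL True xyz v unfolding no312_def by blast
    next
      case False
      then have x: "(x, x') \<in> S" using e(1) by simp
      show False
      proof (cases "(z, z') \<in> L")
        case True
        then have "z' = h" using S(2)[OF x] L[OF True] v by auto
        then show False using e(2) S(2)[OF x] S(2)[of y y'] L[of y y'] v by auto
      next
        case False
        then have z: "(z, z') \<in> S" using e(3) by simp
        then have "(y, y') \<in> S" using e(2) S(2)[OF z] L[of y y'] xyz by auto
        then show False using S(1) x z xyz v unfolding no312_def by blast
      qed
    qed
  qed
qed

text \<open>Sources and targets are relabelled by different maps, since insertion shifts all letters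
  but redirects the edge into 2. The target map need only preserve order on targets that
  occur.\<close>

lemma no312_image:
  assumes "\<And>x y. f x < f y \<longleftrightarrow> x < y" "\<And>x y. x \<in> snd ` E \<Longrightarrow> y \<in> snd ` E \<Longrightarrow> g x < g y \<longleftrightarrow> x < y"
  shows "no312 (map_prod f g ` E) \<longleftrightarrow> no312 E"
proof
  assume H: "no312 (map_prod f g ` E)"
  show "no312 E"
    unfolding no312_def
  proof (intro allI impI)
    fix x y z x' y' z'
    assume e: "(x, x') \<in> E" "(y, y') \<in> E" "(z, z') \<in> E" and "x < y" "y < z"
    moreover have "(f x, g x') \<in> map_prod f g ` E" "(f y, g y') \<in> map_prod f g ` E"
      "(f z, g z') \<in> map_prod f g ` E" using e by force+
    ultimately have "\<not> (g y' < g z' \<and> g z' < g x')"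
      using H assms(1) unfolding no312_def by blast
    moreover have "x' \<in> snd ` E" "y' \<in> snd ` E" "z' \<in> snd ` E" using e by force+
    ultimately show "\<not> (y' < z' \<and> z' < x')" using assms(2) by blast
  qed
next
  assume H: "no312 E"
  show "no312 (map_prod f g ` E)"
    unfolding no312_def
  proof (intro allI impI)
    fix a b c a' b' c'
    assume e: "(a, a') \<in> map_prod f g ` E" "(b, b') \<in> map_prod f g ` E" "(c, c') \<in> map_prod f g ` E"
      and less: "a < b" "b < c"
    obtain x x' where x: "(x, x') \<in> E" "a = f x" "a' = g x'" using e(1) by auto
    obtain y y' where y: "(y, y') \<in> E" "b = f y" "b' = g y'" using e(2) by auto
    obtain z z' where z: "(z, z') \<in> E" "c = f z" "c' = g z'" using e(3) by auto
    have "x < y" "y < z" using less x y z assms(1) by auto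
    then have "\<not> (y' < z' \<and> z' < x')" using H x(1) y(1) z(1) unfolding no312_def by blast
    moreover have "x' \<in> snd ` E" "y' \<in> snd ` E" "z' \<in> snd ` E"
      using x(1) y(1) z(1) by force+
    ultimately show "\<not> (b' < c' \<and> c' < a')" unfolding x y z using assms(2) by blast
  qed
qed

text \<open>A triple \<open>(P, Q, r)\<close> describes the front of a cycle on \<open>{1..n}\<close> in terms of the cycle \<open>C'\<close>
  on \<open>{r + 1..n}\<close> that remains when the letters \<open>1..r\<close> are deleted: \<open>1\<close> and then \<open>P\<close> are put
  in front of \<open>C'\<close>, and \<open>Q\<close> is put directly before the letter \<open>r + 2\<close>, which is the letter \<open>2\<close>
  of \<open>C'\<close> before shifting by \<open>r\<close>.\<close>

definition blocks :: "(nat list \<times> nat list \<times> nat) set" where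
  "blocks = {([], [], 1), ([], [2], 2), ([3], [2], 3), ([], [2, 3], 3), ([4], [2, 3], 4)}"

definition insert_block :: "nat list \<Rightarrow> nat list \<Rightarrow> nat \<Rightarrow> nat list \<Rightarrow> nat list" where
  "insert_block P Q r C =
    1 # P @ map (\<lambda>x. x + r) (takeWhile (\<lambda>x. x \<noteq> 2) C) @ Q @ map (\<lambda>x. x + r) (dropWhile (\<lambda>x. x \<noteq> 2) C)"

text \<open>On both sides a letter smaller than all of the (shifted) \<open>us\<close> follows them,
  so avoidance forces \<open>us\<close> to be sorted. Then everything up to the shifted
  \<open>us\<close> is a sorted prefix. The inserted letters create no pattern: those in
  \<open>1 # P\<close> lie below all letters of the final segment, and \<open>Q\<close> is
  increasing and lies below that segment.\<close>

lemma avoids321_block: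
  assumes blk: "(P, Q, r) \<in> blocks" and pos: "\<And>x. x \<in> set us \<union> set vs \<Longrightarrow> 2 < x"
  shows "avoids321 (1 # P @ map (\<lambda>x. x + r) (1 # us) @ Q @ map (\<lambda>x. x + r) (2 # vs)) \<longleftrightarrow>
    avoids321 (1 # us @ 2 # vs)" (is "avoids321 ?D \<longleftrightarrow> avoids321 ?C")
proof -
  let ?add = "map (\<lambda>x. x + r)"
  have iff: "avoids321 ?D \<longleftrightarrow> avoids321 ?C" if s: "sorted us"
  proof -
    let ?X = "1 # P @ ?add (1 # us)" and ?B = "?add (2 # vs)"
    have sA: "sorted (?add (1 # us))"
      using s pos by (fastforce simp: sorted_map)
    have X: "sorted ?X"
      using blk sA by (auto simp: blocks_def sorted_append)
    have triv: "sorted_wrt (\<lambda>y z. \<not> (z < y \<and> y < x)) ?B" if "x \<le> r" for x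
      by (rule sorted_wrt_mono_rel[of _ "\<lambda>_ _. True"]) (use that in auto)
    have Qle: "q \<le> r" if "q \<in> set Q" for q using blk that by (auto simp: blocks_def)
    have Q: "sorted Q" using blk by (auto simp: blocks_def)
    have low: "x \<le> r" if "x \<in> set (1 # P)" for x using blk that by (auto simp: blocks_def)
    have "avoids321 (Q @ ?B) \<longleftrightarrow> avoids321 ?B"
      unfolding avoids321_sorted_append[OF Q] using triv Qle by blast
    also have "\<dots> \<longleftrightarrow> avoids321 (2 # vs)" by (rule avoids321_map_add)
    finally have QB: "avoids321 (Q @ ?B) \<longleftrightarrow> avoids321 (2 # vs)" .
    have wQB: "sorted_wrt (\<lambda>y z. \<not> (z < y \<and> y < x)) (Q @ ?B) \<longleftrightarrow>
        sorted_wrt (\<lambda>y z. \<not> (z < y \<and> y < x)) ?B" for x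
    proof -
      have "sorted_wrt (\<lambda>y z. \<not> (z < y \<and> y < x)) Q"
        by (rule sorted_wrt_mono_rel[of _ "(\<le>)"]) (use Q in auto)
      moreover have "\<not> (z < y \<and> y < x)" if "y \<in> set Q" "z \<in> set ?B" for y z
        using that Qle[of y] by auto
      ultimately show ?thesis unfolding sorted_wrt_append by blast
    qed
    have "avoids321 ?D \<longleftrightarrow> avoids321 (?X @ Q @ ?B)" by simp
    also have "\<dots> \<longleftrightarrow> avoids321 (2 # vs) \<and>
        (\<forall>x\<in>set ?X. sorted_wrt (\<lambda>y z. \<not> (z < y \<and> y < x)) ?B)"
      by (simp only: avoids321_sorted_append[OF X] QB wQB)
    also have "(\<forall>x\<in>set ?X. sorted_wrt (\<lambda>y z. \<not> (z < y \<and> y < x)) ?B) \<longleftrightarrow>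
        (\<forall>x\<in>set (?add (1 # us)). sorted_wrt (\<lambda>y z. \<not> (z < y \<and> y < x)) ?B)"
    proof -
      have "set ?X = set (1 # P) \<union> set (?add (1 # us))" by auto
      then show ?thesis using triv low by blast
    qed
    also have "\<dots> \<longleftrightarrow> (\<forall>x\<in>set (1 # us). sorted_wrt (\<lambda>y z. \<not> (z < y \<and> y < x)) (2 # vs))"
      by (simp add: sorted_wrt_map)
    also have "avoids321 (2 # vs) \<and> \<dots> \<longleftrightarrow> avoids321 ((1 # us) @ 2 # vs)"
      by (rule avoids321_sorted_append[symmetric]) (use s pos in force)
    finally show ?thesis by simp
  qed
  have "sorted us" if "avoids321 ?C"
    using avoids321_imp_sorted_prefix[of us 2 vs] that pos by simp
  moreover have "sorted us" if D: "avoids321 ?D"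
  proof -
    \<comment> \<open>\<open>h\<close> is the letter directly after the shifted
      \<open>us\<close>.\<close>
    define h where "h = hd (Q @ [2 + r])"
    obtain R where R: "Q @ ?add (2 # vs) = h # R" by (cases Q) (auto simp: h_def)
    have "avoids321 (?add us @ h # R)"
      using avoids321_appendD[of "1 # P @ [1 + r]" "?add us @ h # R"] D R[symmetric] by simp
    moreover have "h < x" if "x \<in> set (?add us)" for x
      using that pos blk by (fastforce simp: h_def blocks_def)
    ultimately have "sorted (?add us)" by (rule avoids321_imp_sorted_prefix)
    then show ?thesis by (simp add: sorted_map)
  qed
  ultimately show ?thesis using iff by blast
qed

text \<open>The edges of the longer list are the low edges \<open>S\<close> together with the old
  edges, whose sources are shifted by \<open>r\<close> and whose targets are changed by
  \<open>g\<close>: shifted by \<open>r\<close>, except that 2 becomes the head \<open>h\<close> of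
  what now stands there.\<close>

lemma no312_block:
  assumes blk: "(P, Q, r) \<in> blocks" and pos: "\<And>x. x \<in> set us \<union> set vs \<Longrightarrow> 2 < x"
  shows "no312 (edges (1 # P @ map (\<lambda>x. x + r) (1 # us) @ Q @ map (\<lambda>x. x + r) (2 # vs))) \<longleftrightarrow>
    no312 (edges (1 # us @ 2 # vs))" (is "no312 (edges ?D) \<longleftrightarrow> no312 (edges ?C)")
proof -
  let ?add = "\<lambda>x. x + r" and ?A = "1 # us" and ?B = "2 # vs"
  define h where "h = hd (Q @ [r + 2])"
  define g where "g = (\<lambda>x. if x = 2 then h else x + r)"
  define S where "S = edges (1 # P @ [r + 1]) \<union> edges (Q @ [r + 2])"
  have h: "h \<le> r + 2" using blk by (auto simp: h_def blocks_def)
  have C: "edges ?C = insert (last ?A, 2) (edges ?A \<union> edges ?B)"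
    using edges_append[of ?A ?B] by simp
  have snd_AB: "2 < y" if "(x, y) \<in> edges ?A \<union> edges ?B" for x y
    using that edges_mem[of x y ?A] edges_mem[of x y ?B] pos by auto
  have "map_prod ?add g ` edges ?C =
      insert (last ?A + r, h) (map_prod ?add ?add ` (edges ?A \<union> edges ?B))"
  proof -
    have "map_prod ?add g ` (edges ?A \<union> edges ?B) = map_prod ?add ?add ` (edges ?A \<union> edges ?B)"
    proof (rule image_cong[OF refl])
      fix e assume "e \<in> edges ?A \<union> edges ?B"
      then show "map_prod ?add g e = map_prod ?add ?add e"
        using snd_AB[of "fst e" "snd e"] by (cases e) (simp add: g_def)
    qed
    then show ?thesis by (simp only: C image_insert map_prod_simp) (simp add: g_def)
  qed
  also have "\<dots> = insert (last (map ?add ?A), hd (Q @ map ?add ?B))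
      (edges (map ?add ?A) \<union> edges (map ?add ?B))"
    by (cases Q) (simp_all only: h_def edges_map image_Un, simp_all add: last_map)
  finally have L: "map_prod ?add g ` edges ?C = \<dots>" .
  have "edges ?D = edges ((1 # P) @ map ?add ?A @ Q @ map ?add ?B)" by simp
  also have "\<dots> = edges ((1 # P) @ [r + 1]) \<union> edges (map ?add ?A @ Q @ map ?add ?B)"
    by (subst edges_append_hd) auto
  also have "edges (map ?add ?A @ Q @ map ?add ?B) = insert (last (map ?add ?A), hd (Q @ map ?add ?B))
      (edges (map ?add ?A) \<union> edges (Q @ map ?add ?B))"
    by (rule edges_append) auto
  also have "edges (Q @ map ?add ?B) = edges (Q @ [r + 2]) \<union> edges (map ?add ?B)"
    by (subst edges_append_hd) auto
  finally have D: "edges ?D = S \<union> map_prod ?add g ` edges ?C"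
    unfolding L S_def by auto
  have "no312 (edges ?D) \<longleftrightarrow> no312 (map_prod ?add g ` edges ?C)"
    unfolding D
  proof (rule no312_Un_low)
    show "no312 S"
      using blk unfolding blocks_def S_def no312_def by auto
    show "x \<le> r \<and> x' \<le> r + 2 \<and> (h \<le> x' \<or> h = r + 2)" if "(x, x') \<in> S" for x x'
      using blk that unfolding blocks_def S_def h_def by auto
    fix x x' assume "(x, x') \<in> map_prod ?add g ` edges ?C"
    then obtain y y' where y: "(y, y') \<in> edges ?C" "x = y + r" "x' = g y'" by auto
    have "y \<in> set ?C" "y' \<in> set (us @ 2 # vs)" using edges_mem[OF y(1)] by auto
    then show "r < x \<and> (x' = h \<or> r + 2 < x')"
      using pos y by (force simp: g_def)
  qed
  also have "\<dots> \<longleftrightarrow> no312 (edges ?C)"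
  proof (rule no312_image)
    \<comment> \<open>The letter 1 stands first and is never a target. On targets from 2 on,
      \<open>g\<close> preserves order because \<open>h \<le> r + 2\<close>.\<close>
    have ge: "2 \<le> x" if x: "x \<in> snd ` edges ?C" for x
    proof -
      obtain w where "(w, x) \<in> edges ?C" using x by force
      then have "x = 2 \<or> (w, x) \<in> edges ?A \<union> edges ?B" unfolding C by blast
      then show ?thesis using snd_AB[of w x] by auto
    qed
    fix x y assume "x \<in> snd ` edges ?C" "y \<in> snd ` edges ?C"
    then have "2 \<le> x" "2 \<le> y" using ge by auto
    then show "g x < g y \<longleftrightarrow> x < y" using h by (auto simp: g_def)
  qed simp
  finally show ?thesis .
qed

text \<open>The implication from right to left serves for inserting a block, the converse for
  deleting one.\<close>

lemma block_in_cycle_lists_iff: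
  assumes blk: "(P, Q, r) \<in> blocks" and dist: "distinct (1 # us @ 2 # vs)"
    and set: "set (1 # us @ 2 # vs) = {1..m}"
  shows "1 # P @ map (\<lambda>x. x + r) (1 # us) @ Q @ map (\<lambda>x. x + r) (2 # vs) \<in> cycle_lists (m + r) \<longleftrightarrow>
    1 # us @ 2 # vs \<in> cycle_lists m" (is "?D \<in> _ \<longleftrightarrow> ?C \<in> _")
proof -
  let ?add = "\<lambda>x::nat. x + r"
  have pos: "2 < x" if x: "x \<in> set us \<union> set vs" for x
  proof -
    have "x \<in> {1..m}" using x set by auto
    moreover have "x \<noteq> 1" "x \<noteq> 2" using x dist by auto
    ultimately show ?thesis by auto
  qed
  have m: "2 \<le> m" using set by auto
  have setD: "set ?D = {1..m + r}"
  proof -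
    have "set ?D = ({1} \<union> set P \<union> set Q) \<union> ?add ` set ?C" by auto
    \<comment> \<open>In each of the five blocks the inserted letters are exactly
      \<open>1..r\<close>.\<close>
    also have "{1} \<union> set P \<union> set Q = {1..r}"
      using blk by (auto simp: blocks_def)
    also have "?add ` set ?C = {1 + r..m + r}"
      unfolding set by (rule image_add_atLeastAtMost')
    also have "{1..r} \<union> {1 + r..m + r} = {1..m + r}" by auto
    finally show ?thesis .
  qed
  have "length ?C = m" using distinct_card[OF dist] set by simp
  then have "length ?D = m + r" using blk by (auto simp: blocks_def)
  then have "distinct ?D" using setD by (intro card_distinct) simp
  moreover have "last ?D = m + r \<longleftrightarrow> last ?C = m"
    by (simp add: last_map)
  ultimately show ?thesis
    using avoids321_block[OF blk pos, of us vs] no312_block[OF blk pos, of us vs] setD dist set m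
    unfolding cycle_lists_def mem_Collect_eq by auto
qed

section \<open>Injectivity of insertion and recognition of the block\<close>

lemma cycle_lists_split:
  assumes "C \<in> cycle_lists m"
  obtains us vs where "C = 1 # us @ 2 # vs"
proof -
  have C: "2 \<le> m" "set C = {1..m}" "hd C = 1" using assms by (auto simp: cycle_lists_def)
  obtain c rest where "C = c # rest" using C by (cases C) auto
  moreover have "2 \<in> set C" using C by auto
  ultimately have "C = 1 # rest" "2 \<in> set rest" using C(3) by auto
  then show thesis using that by (metis split_list)
qed

lemma insert_block_split:
  assumes "2 \<notin> set us"
  shows "insert_block P Q r (1 # us @ 2 # vs) =
    1 # P @ map (\<lambda>x. x + r) (1 # us) @ Q @ map (\<lambda>x. x + r) (2 # vs)"
proof -
  have "takeWhile (\<lambda>x. x \<noteq> 2) (us @ 2 # vs) = us"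
    using assms by (induction us) auto
  moreover have "dropWhile (\<lambda>x. x \<noteq> 2) (us @ 2 # vs) = 2 # vs"
    using assms by (induction us) auto
  ultimately show ?thesis by (simp add: insert_block_def)
qed

lemma insert_block_in_cycle_lists:
  assumes "(P, Q, r) \<in> blocks" "C \<in> cycle_lists m"
  shows "insert_block P Q r C \<in> cycle_lists (m + r)"
proof -
  obtain us vs where C: "C = 1 # us @ 2 # vs" using cycle_lists_split[OF assms(2)] .
  have "distinct C" "set C = {1..m}" using assms(2) by (auto simp: cycle_lists_def)
  then show ?thesis
    using block_in_cycle_lists_iff[OF assms(1), of us vs m] assms(2) insert_block_split[of us]
    unfolding C by simp
qed

text \<open>Keeping the letters above \<open>r\<close> and shifting them down by \<open>r\<close>
  recovers \<open>C\<close>.\<close>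

lemma inj_on_insert_block:
  assumes "(P, Q, r) \<in> blocks"
  shows "inj_on (insert_block P Q r) (cycle_lists m)"
proof (rule inj_on_inverseI)
  fix C assume "C \<in> cycle_lists m"
  then have pos: "x > 0" if "x \<in> set C" for x using that by (auto simp: cycle_lists_def)
  have low: "filter (\<lambda>x. r < x) (1 # P) = []" "filter (\<lambda>x. r < x) Q = []"
    using assms by (auto simp: blocks_def)
  have high: "filter (\<lambda>x. r < x) (map (\<lambda>x. x + r) xs) = map (\<lambda>x. x + r) xs" if "set xs \<subseteq> set C" for xs
    using that pos by (intro filter_True) auto
  have "filter (\<lambda>x. r < x) (insert_block P Q r C) = filter (\<lambda>x. r < x) ((1 # P) @
      map (\<lambda>x. x + r) (takeWhile (\<lambda>x. x \<noteq> 2) C) @ Q @ map (\<lambda>x. x + r) (dropWhile (\<lambda>x. x \<noteq> 2) C))"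
    by (simp add: insert_block_def)
  also have "\<dots> = map (\<lambda>x. x + r) (takeWhile (\<lambda>x. x \<noteq> 2) C @ dropWhile (\<lambda>x. x \<noteq> 2) C)"
    unfolding filter_append low map_append
    by (subst high, blast dest: set_takeWhileD, subst high, blast dest: set_dropWhileD) simp
  finally show "map (\<lambda>x. x - r) (filter (\<lambda>x. r < x) (insert_block P Q r C)) = C"
    by (simp add: comp_def)
qed

text \<open>The second and third entry of a cycle identify the block at its front.\<close>

definition block_key :: "nat list \<Rightarrow> nat \<times> bool" where
  "block_key C = (C ! 1, C ! 1 \<noteq> 2 \<and> C ! 2 = Suc (C ! 1))"

text \<open>A nonempty \<open>P\<close> is \<open>[r]\<close> and is followed by
  \<open>r + 1\<close>. If \<open>P\<close> is empty and \<open>r > 1\<close>, then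
  \<open>r + 1\<close> is followed by 2 or by a letter above \<open>r + 2\<close>. Only for
  \<open>r = 1\<close> can \<open>r + 2\<close> follow directly, whence the test for 2 in
  \<open>block_key\<close>.\<close>

lemma block_key_insert_block:
  assumes "(P, Q, r) \<in> blocks" "C \<in> cycle_lists m"
  shows "block_key (insert_block P Q r C) = (hd (P @ [r + 1]), P \<noteq> [])"
proof -
  obtain us vs where C: "C = 1 # us @ 2 # vs" using cycle_lists_split[OF assms(2)] .
  have us: "2 < x" if "x \<in> set us" for x
  proof -
    have "distinct C" "set C = {1..m}" using assms(2) by (auto simp: cycle_lists_def)
    moreover have "x \<in> set C" using that by (simp add: C)
    ultimately have "1 \<le> x" "x \<noteq> 1" "x \<noteq> 2" using that by (auto simp: C)
    then show ?thesis by simp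
  qed
  then have "insert_block P Q r C = 1 # P @ map (\<lambda>x. x + r) (1 # us) @ Q @ map (\<lambda>x. x + r) (2 # vs)"
    unfolding C by (intro insert_block_split) auto
  then show ?thesis
    using assms(1) us unfolding block_key_def blocks_def by (cases us) fastforce+
qed

lemma inj_on_block_key: "inj_on (\<lambda>(P, Q, r). (hd (P @ [r + 1]), P \<noteq> [])) blocks"
  by (simp add: blocks_def)

subsection \<open>Decomposition of avoiding cycles\<close>

lemma edges_split: "xs \<noteq> [] \<Longrightarrow> (last xs, y) \<in> edges (xs @ y # ys)"
  by (simp add: edges_append)

text \<open>Let \<open>k = \<pi> 1\<close> and let \<open>p\<close> be the predecessor of \<open>2\<close> in the cycle. Everything before \<open>2\<close> is
  increasing by 321-avoidance. If a letter \<open>t\<close> lies after \<open>2\<close> and has predecessor \<open>q > t\<close> there, then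
  312-avoidance forces \<open>q < p\<close> as soon as some position below \<open>p\<close> carries a value above \<open>t\<close>, and
  then \<open>p, q, t\<close> is a 321 pattern of the cycle. Together with 312 patterns
  that start at position 1, 2 or 3 this excludes all but the five blocks.\<close>

lemma cycle_lists_decomp:
  assumes C: "C \<in> cycle_lists n" and n: "3 \<le> n"
  obtains P Q r us vs where "(P, Q, r) \<in> blocks" "C = 1 # P @ (r + 1) # us @ Q @ (r + 2) # vs"
proof -
  have dist: "distinct C" and set: "set C = {1..n}" and "hd C = 1" and lst: "last C = n"
    and av: "avoids321 C" and no: "no312 (edges C)"
    using C by (auto simp: cycle_lists_def)
  have no': "\<not> (y' < z' \<and> z' < x')"
    if "(x, x') \<in> edges C" "(y, y') \<in> edges C" "(z, z') \<in> edges C" "x < y" "y < z" for x y z x' y' z'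
    using no that unfolding no312_def by blast
  have "length C = n" using distinct_card[OF dist] set by simp
  then obtain k rest where Ck: "C = 1 # k # rest"
    using n \<open>hd C = 1\<close> by (cases C; cases "tl C") auto
  have kn: "2 \<le> k" "k \<le> n"
  proof -
    have "k \<in> {1..n}" unfolding set[symmetric] by (simp add: Ck)
    moreover have "k \<noteq> 1" using dist by (simp add: Ck)
    ultimately show "2 \<le> k" "k \<le> n" by auto
  qed
  have pos: "1 < x" if "x \<in> set (k # rest)" for x
  proof -
    have "x \<in> {1..n}" unfolding set[symmetric] using that by (simp add: Ck)
    moreover have "x \<noteq> 1" using that dist by (auto simp: Ck)
    ultimately show ?thesis by auto
  qed
  show thesis
  proof (cases "k = 2")
    case True
    have "3 \<in> set C" using set n by auto
    then have "3 \<in> set rest" using True by (simp add: Ck)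
    then obtain us vs where "rest = us @ 3 # vs" by (meson split_list)
    then show thesis using that[of "[]" "[]" 1 us vs] True by (simp add: Ck blocks_def numeral_3_eq_3)
  next
    case False
    then have k3: "3 \<le> k" using kn by simp
    have "2 \<in> set C" using set n by auto
    then have "2 \<in> set rest" using False by (simp add: Ck)
    then obtain us vs where rest: "rest = us @ 2 # vs" by (meson split_list)
    define p where "p = last (k # us)"
    have p_mem: "p \<in> set (k # us)" unfolding p_def by (rule last_in_set) simp
    have e1: "(1, k) \<in> edges C" by (simp add: Ck)
    have e2: "(p, 2) \<in> edges C"
      using edges_split[of "1 # k # us" 2 vs] by (simp add: Ck rest p_def)
    have "sorted (k # us)"
    proof (rule avoids321_imp_sorted_prefix)
      show "avoids321 ((k # us) @ 2 # vs)" using av by (simp add: Ck rest)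
      fix x assume x: "x \<in> set (k # us)"
      then have "1 < x" using pos by (auto simp: rest)
      moreover have "x \<noteq> 2" using x dist by (auto simp: Ck rest)
      ultimately show "2 < x" by simp
    qed
    then have us_gt: "k < u" if "u \<in> set us" for u
      using that dist by (auto simp: Ck rest less_le)
    have p: "k \<le> p" using p_mem us_gt by (auto dest: less_imp_le)
    have in_vs: "j \<in> set vs" if "3 \<le> j" "j < k" for j
    proof -
      have "j \<in> set C" using set that kn by auto
      then show ?thesis using that us_gt[of j] by (auto simp: Ck rest)
    qed
    have three: "\<exists>zs. vs = 3 # zs" if k4: "4 \<le> k"
    proof -
      obtain ys zs where vs: "vs = ys @ 3 # zs" using in_vs[of 3] k4 by (auto dest: split_list)
      have "ys = []"
      proof (rule ccontr)
        assume ys: "ys \<noteq> []"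
        define q where "q = last ys"
        have q_mem: "q \<in> set ys" using ys by (simp add: q_def)
        have e3: "(q, 3) \<in> edges C"
          using edges_split[of "1 # k # us @ 2 # ys" 3 zs] ys by (simp add: Ck rest vs q_def)
        have "q \<noteq> 2" "q \<noteq> 3" "p \<noteq> q" using q_mem p_mem dist by (auto simp: Ck rest vs)
        moreover have "1 < q" using pos q_mem by (auto simp: rest vs)
        ultimately have q3: "3 < q" by simp
        \<comment> \<open>Here \<open>t = 3\<close>: positions \<open>1 < p < q\<close> would carry
          the values \<open>k\<close>, 2, 3.\<close>
        have "\<not> p < q" using no'[OF e1 e2 e3] p k4 by auto
        then have "q < p" using \<open>p \<noteq> q\<close> by simp
        then show False
          using avoids321D[of "1 # k # us" "2 # ys" "3 # zs" p q 3] av q3 q_mem p_mem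
          by (auto simp: Ck rest vs)
      qed
      then show ?thesis using vs by simp
    qed
    have "k \<le> 4"
    proof (rule ccontr)
      assume "\<not> k \<le> 4"
      then obtain zs where vs: "vs = 3 # zs" using three by auto
      have "4 \<in> set zs" using in_vs[of 4] \<open>\<not> k \<le> 4\<close> by (simp add: vs)
      then obtain as bs where zs: "zs = as @ 4 # bs" by (meson split_list)
      define q where "q = last (3 # as)"
      have q_mem: "q \<in> set (3 # as)" unfolding q_def by (rule last_in_set) simp
      have e3: "(2, 3) \<in> edges C"
        using edges_split[of "1 # k # us @ [2]" 3 zs] by (simp add: Ck rest vs)
      have e4: "(q, 4) \<in> edges C"
        using edges_split[of "1 # k # us @ 2 # 3 # as" 4 bs] by (simp add: Ck rest vs zs q_def)
      have "1 < q" "q \<noteq> 2" using q_mem pos dist by (auto simp: Ck rest vs zs)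
      \<comment> \<open>For \<open>k > 4\<close> the positions \<open>1 < 2 < q\<close> carry the
        values \<open>k\<close>, 3, 4.\<close>
      then show False using no'[OF e1 e3 e4] \<open>\<not> k \<le> 4\<close> by simp
    qed
    then have "k = 3 \<or> k = 4" using k3 by auto
    \<comment> \<open>\<open>Q\<close> is the run \<open>2..k - 1\<close>. What remains is to decide
      whether \<open>k\<close> plays the role of \<open>r + 1\<close> or of the single letter in
      \<open>P\<close>.\<close>
    then obtain Q ws where Q: "2 # vs = Q @ ws" "k = 3 \<and> Q = [2] \<or> k = 4 \<and> Q = [2, 3]"
      using three by fastforce
    have Q': "Q \<noteq> []" "last Q = k - 1" "set Q = {2..k - 1}" using Q(2) by auto
    have C': "C = 1 # k # us @ Q @ ws" using Q(1) by (simp add: Ck rest)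
    have "ws \<noteq> []"
    proof
      assume "ws = []"
      then have "last C = k - 1" using Q' by (simp add: C')
      then show False using lst kn by simp
    qed
    then obtain s ts where ws: "ws = s # ts" by (cases ws) auto
    have ws_gt: "k < x" if "x \<in> set ws" for x
    proof -
      have "x \<noteq> k" "x \<notin> {2..k - 1}" using that dist Q'(3) by (auto simp: C')
      moreover have "1 < x" using that pos Ck C' by auto
      ultimately show ?thesis by auto
    qed
    have e3: "(k - 1, s) \<in> edges C"
      using edges_split[of "1 # k # us @ Q" s ts] Q' by (simp add: C' ws)
    have sk: "k < s" using ws_gt ws by simp
    have "s \<in> set C" by (simp add: C' ws)
    then have sn: "s \<le> n" using set by simp
    have rs: "([], Q, k - 1) \<in> blocks" "([k], Q, k) \<in> blocks"
      using Q(2) by (auto simp: blocks_def)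
    show thesis
    proof (cases "s = k + 1")
      case True
      have "C = 1 # [] @ (k - 1 + 1) # us @ Q @ (k - 1 + 2) # ts"
        using k3 by (simp add: C' ws True)
      then show thesis using that rs(1) by blast
    next
      case False
      then have sk2: "k + 1 < s" using sk by simp
      \<comment> \<open>Otherwise \<open>k + 1\<close> comes after \<open>s\<close>, and the same
        argument applies with \<open>t = k + 1\<close>: position \<open>k - 1 < p\<close> carries
        \<open>s > k + 1\<close>.\<close>
      have "k + 1 \<in> set us"
      proof (rule ccontr)
        assume no_us: "k + 1 \<notin> set us"
        have "k + 1 \<in> set C" using set sk2 sn by simp
        then have "k + 1 \<in> set ts" using no_us False Q'(3) k3 by (auto simp: C' ws)
        then obtain as bs where ts: "ts = as @ (k + 1) # bs" by (meson split_list)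
        define q where "q = last (s # as)"
        have q_mem: "q \<in> set (s # as)" unfolding q_def by (rule last_in_set) simp
        have e4: "(q, k + 1) \<in> edges C"
          using edges_split[of "1 # k # us @ Q @ s # as" "k + 1" bs] by (simp add: C' ws ts q_def)
        have "k < q" using q_mem ws_gt by (auto simp: ws ts)
        moreover have "q \<noteq> k + 1" "p \<noteq> q" using q_mem p_mem dist by (auto simp: C' ws ts)
        moreover have "k - 1 < p" using p k3 by linarith
        then have "\<not> p < q" using no'[OF e3 e2 e4] k3 sk2 by auto
        ultimately have "k + 1 < q" "q < p" by auto
        then show False
          using avoids321D[of "1 # k # us" "Q @ s # as" "(k + 1) # bs" p q "k + 1"] av q_mem p_mem
          by (auto simp: C' ws ts)
      qed
      then obtain u us' where us: "us = u # us'" by (cases us) auto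
      have "u \<le> k + 1" using \<open>sorted (k # us)\<close> \<open>k + 1 \<in> set us\<close> by (auto simp: us)
      then have u: "u = k + 1" using us_gt[of u] by (simp add: us)
      have e4: "(k, k + 1) \<in> edges C" by (simp add: C' us u)
      have "s = k + 2"
      proof (rule ccontr)
        assume "s \<noteq> k + 2"
        then have s3: "k + 2 < s" using sk2 by simp
        \<comment> \<open>Wherever \<open>k + 2\<close> stands, its predecessor \<open>q\<close>
          exceeds \<open>k\<close>, so positions \<open>k - 1 < k < q\<close> would carry
          \<open>s\<close>, \<open>k + 1\<close>, \<open>k + 2\<close>.\<close>
        have "\<exists>q. (q, k + 2) \<in> edges C \<and> k < q"
        proof -
          have "k + 2 \<in> set C" using set s3 sn by simp
          then have "k + 2 \<in> set us' \<or> k + 2 \<in> set ts"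
            using s3 Q'(3) k3 by (auto simp: C' ws us u)
          then show ?thesis
          proof
            assume "k + 2 \<in> set us'"
            then obtain as bs where us': "us' = as @ (k + 2) # bs" by (meson split_list)
            have "last (u # as) \<in> set us" unfolding us us' by (metis Cons_eq_appendI UnCI last_in_set list.distinct(1) set_append)
            moreover have "(last (u # as), k + 2) \<in> edges C"
              using edges_split[of "1 # k # u # as" "k + 2" "bs @ Q @ ws"] by (simp add: C' us us')
            ultimately show ?thesis using us_gt by blast
          next
            assume "k + 2 \<in> set ts"
            then obtain as bs where ts: "ts = as @ (k + 2) # bs" by (meson split_list)
            have "last (s # as) \<in> set ws" unfolding ws ts by (metis Cons_eq_appendI UnCI last_in_set list.distinct(1) set_append)
            moreover have "(last (s # as), k + 2) \<in> edges C"
              using edges_split[of "1 # k # us @ Q @ s # as" "k + 2" bs] by (simp add: C' ws ts)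
            ultimately show ?thesis using ws_gt by blast
          qed
        qed
        then obtain q where "(q, k + 2) \<in> edges C" "k < q" by blast
        then show False using no'[OF e3 e4, of q "k + 2"] k3 s3 by simp
      qed
      then have "C = 1 # [k] @ (k + 1) # us' @ Q @ (k + 2) # ts"
        by (simp add: C' ws us u)
      then show thesis using that rs(2) by blast
    qed
  qed
qed

lemma cycle_lists_eq_Union:
  assumes "3 \<le> n"
  shows "cycle_lists n = (\<Union>(P, Q, r)\<in>blocks. insert_block P Q r ` cycle_lists (n - r))"
proof (intro equalityI subsetI)
  fix C assume C: "C \<in> cycle_lists n"
  obtain P Q r us vs where blk: "(P, Q, r) \<in> blocks"
    and C_eq: "C = 1 # P @ (r + 1) # us @ Q @ (r + 2) # vs"
    using cycle_lists_decomp[OF C assms] .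
  have dist: "distinct C" and set: "set C = {1..n}" using C by (auto simp: cycle_lists_def)
  have low: "{1} \<union> set P \<union> set Q = {1..r}" using blk by (auto simp: blocks_def)
  \<comment> \<open>The remaining letters exceed \<open>r + 2\<close>, so subtracting
    \<open>r\<close> from them is undone by adding it.\<close>
  have "set us \<union> set vs \<subseteq> {r + 2<..n}"
  proof
    fix x assume x: "x \<in> set us \<union> set vs"
    then have "x \<in> {1..n}" using set C_eq by auto
    moreover have "x \<notin> {1} \<union> set P \<union> set Q" "x \<noteq> r + 1" "x \<noteq> r + 2"
      using x dist by (auto simp: C_eq)
    ultimately show "x \<in> {r + 2<..n}" unfolding low by auto
  qed
  then have add_sub: "map (\<lambda>x. x + r) (map (\<lambda>x. x - r) us) = us"
    "map (\<lambda>x. x + r) (map (\<lambda>x. x - r) vs) = vs"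
    by (auto intro!: map_idI)
  define us' vs' where "us' = map (\<lambda>x. x - r) us" and "vs' = map (\<lambda>x. x - r) vs"
  let ?C' = "1 # us' @ 2 # vs'"
  have C_eq': "C = 1 # P @ map (\<lambda>x. x + r) (1 # us') @ Q @ map (\<lambda>x. x + r) (2 # vs')"
    using add_sub by (simp add: C_eq us'_def vs'_def del: map_map)
  have "r + 2 \<in> set C" by (simp add: C_eq)
  then have rn: "r + 2 \<le> n" using set by simp
  have add_C': "map (\<lambda>x. x + r) ?C' = (r + 1) # us @ (r + 2) # vs"
    using add_sub by (simp add: us'_def vs'_def del: map_map)
  have "distinct ((r + 1) # us @ (r + 2) # vs)" using dist by (auto simp: C_eq)
  then have "distinct (map (\<lambda>x. x + r) ?C')" by (simp only: add_C')
  then have dist': "distinct ?C'" by (simp only: distinct_map)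
  have "set ((r + 1) # us @ (r + 2) # vs) = set C - ({1} \<union> set P \<union> set Q)"
    using dist by (auto simp: C_eq)
  also have "\<dots> = {1..n} - {1..r}" by (simp only: set low)
  also have "\<dots> = {1 + r..(n - r) + r}" using rn by auto
  also have "\<dots> = (\<lambda>x. x + r) ` {1..n - r}" by (rule image_add_atLeastAtMost'[symmetric])
  finally have "(\<lambda>x. x + r) ` set ?C' = (\<lambda>x. x + r) ` {1..n - r}"
    unfolding add_C'[symmetric] set_map .
  moreover have "inj (\<lambda>x. x + r)" by (rule injI) simp
  ultimately have set': "set ?C' = {1..n - r}" by (simp only: inj_image_eq_iff)
  have "?C' \<in> cycle_lists (n - r)"
    using block_in_cycle_lists_iff[OF blk dist' set'] C rn unfolding C_eq' by simp
  moreover have "2 \<notin> set us'" using dist' by simp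
  then have "C = insert_block P Q r ?C'" unfolding C_eq' by (rule insert_block_split[symmetric])
  ultimately show "C \<in> (\<Union>(P, Q, r)\<in>blocks. insert_block P Q r ` cycle_lists (n - r))"
    using blk by blast
next
  fix C assume "C \<in> (\<Union>(P, Q, r)\<in>blocks. insert_block P Q r ` cycle_lists (n - r))"
  then obtain P Q r C' where blk: "(P, Q, r) \<in> blocks" and C': "C' \<in> cycle_lists (n - r)"
    "C = insert_block P Q r C'" by auto
  \<comment> \<open>This excludes truncation, so that \<open>n - r + r = n\<close>.\<close>
  have "2 \<le> n - r" using C' by (simp add: cycle_lists_def)
  then show "C \<in> cycle_lists n" using insert_block_in_cycle_lists[OF blk C'(1)] C'(2) by simp
qed

section \<open>Counting by blocks\<close>

lemma finite_cycle_lists: "finite (cycle_lists n)"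
proof (rule finite_subset)
  show "cycle_lists n \<subseteq> {xs. set xs \<subseteq> {1..n} \<and> length xs \<le> n}"
    by (auto simp: cycle_lists_def dest: distinct_card)
qed (rule finite_lists_length_le, simp)

text \<open>Distinct keys make the union over the blocks disjoint, and injectivity of insertion
  gives the size of each part.\<close>

lemma card_cycle_lists_rec:
  assumes "3 \<le> n"
  shows "card (cycle_lists n) = card (cycle_lists (n - 1)) + card (cycle_lists (n - 2))
    + 2 * card (cycle_lists (n - 3)) + card (cycle_lists (n - 4))"
proof -
  let ?F = "\<lambda>(P, Q, r). insert_block P Q r ` cycle_lists (n - r)"
  have "card (cycle_lists n) = card (\<Union>b\<in>blocks. ?F b)"
    by (simp only: cycle_lists_eq_Union[OF assms])
  also have "\<dots> = (\<Sum>b\<in>blocks. card (?F b))"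
  proof (rule card_UN_disjoint)
    show "finite blocks" by (simp add: blocks_def)
    show "\<forall>b\<in>blocks. finite (?F b)" using finite_cycle_lists by auto
    show "\<forall>b\<in>blocks. \<forall>b'\<in>blocks. b \<noteq> b' \<longrightarrow> ?F b \<inter> ?F b' = {}"
    proof (intro ballI impI)
      fix b b' assume b: "b \<in> blocks" "b' \<in> blocks" "b \<noteq> b'"
      have key: "block_key D = (case c of (P, Q, r) \<Rightarrow> (hd (P @ [r + 1]), P \<noteq> []))"
        if "c \<in> blocks" "D \<in> ?F c" for c D
        using that block_key_insert_block by (cases c) auto
      show "?F b \<inter> ?F b' = {}"
      proof (rule ccontr)
        assume "?F b \<inter> ?F b' \<noteq> {}"
        then obtain D where "D \<in> ?F b" "D \<in> ?F b'" by blast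
        then have "(case b of (P, Q, r) \<Rightarrow> (hd (P @ [r + 1]), P \<noteq> [])) =
            (case b' of (P, Q, r) \<Rightarrow> (hd (P @ [r + 1]), P \<noteq> []))"
          using key[OF b(1), of D] key[OF b(2), of D] by simp
        then have "b = b'" by (rule inj_onD[OF inj_on_block_key _ b(1,2)])
        then show False using b(3) by simp
      qed
    qed
  qed
  also have "\<dots> = (\<Sum>(P, Q, r)\<in>blocks. card (cycle_lists (n - r)))"
    by (intro sum.cong refl) (auto intro: card_image inj_on_insert_block)
  finally show ?thesis by (simp add: blocks_def)
qed

lemma card_cycle_lists_less_2: "n < 2 \<Longrightarrow> card (cycle_lists n) = 0"
  by (simp add: cycle_lists_def)

lemma card_cycle_lists_2: "card (cycle_lists 2) = 1"
proof -
  have "C = [1, 2]" if C: "C \<in> cycle_lists 2" for C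
  proof -
    have "length C = 2" using C distinct_card[of C] by (auto simp: cycle_lists_def)
    then obtain a b where "C = [a, b]" by (metis length_0_conv length_Suc_conv numeral_2_eq_2)
    then show ?thesis using C by (simp add: cycle_lists_def)
  qed
  moreover have "[1, 2] \<in> cycle_lists 2" by (auto simp: cycle_lists_def no312_def)
  ultimately have "cycle_lists 2 = {[1, 2]}" by blast
  then show ?thesis by simp
qed

subsection \<open>The generating function\<close>

unbundle fps_syntax

text \<open>The double sum of the theorem with \<open>m = n - 2\<close>.\<close>

definition closed_form :: "nat \<Rightarrow> nat" where
  "closed_form m = (\<Sum>k=0..m div 2. \<Sum>j=0..m - 2 * k. ((m - k - j) choose k) * ((2 * k) choose j))"

text \<open>This is \<open>x\<^sup>2\<^sup>k / (1 - x)\<^sup>k\<^sup>+\<^sup>1\<close>; for \<open>i < k\<close> the truncated subtraction gives the correct value,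
  since \<open>k > 0\<close> then.\<close>

definition diag_fps :: "nat \<Rightarrow> nat fps" where
  "diag_fps k = Abs_fps (\<lambda>i. (i - k) choose k)"

text \<open>The geometric series \<open>1 / (1 - x)\<close>, with the denominator multiplied out
  because natural coefficients allow no subtraction.\<close>

lemma diag_fps_0: "diag_fps 0 = 1 + fps_X * diag_fps 0"
  by (rule fps_ext) (auto simp: diag_fps_def)

text \<open>Pascal's rule in each coefficient, away from the truncated range.\<close>

lemma diag_fps_Suc: "diag_fps (Suc k) = fps_X * diag_fps (Suc k) + fps_X\<^sup>2 * diag_fps k"
proof (rule fps_ext)
  fix i
  show "diag_fps (Suc k) $ i = (fps_X * diag_fps (Suc k) + fps_X\<^sup>2 * diag_fps k) $ i"
  proof (cases "i \<le> Suc k")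
    case True
    then show ?thesis
      by (auto simp: diag_fps_def fps_X_power_mult_nth)
  next
    case False
    then obtain l where "i = Suc (Suc (k + l))"
      by (metis add_Suc_right less_iff_Suc_add not_le_imp_less add_Suc)
    then show ?thesis
      by (simp add: diag_fps_def fps_X_power_mult_nth)
  qed
qed

lemma one_plus_X_power_nth: "((1 + fps_X :: nat fps) ^ n) $ j = n choose j"
proof (induction n arbitrary: j)
  case (Suc n)
  then show ?case by (cases j) (simp_all add: algebra_simps)
qed simp

text \<open>The term \<open>(x^2 (1 + x)^2)^k / (1 - x)^(k + 1)\<close> of the geometric
  expansion.\<close>

definition term_fps :: "nat \<Rightarrow> nat fps" where
  "term_fps k = diag_fps k * (1 + fps_X) ^ (2 * k)"

lemma term_fps_0: "term_fps 0 = 1 + fps_X * term_fps 0"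
  using diag_fps_0 by (simp add: term_fps_def)

lemma term_fps_Suc:
  "term_fps (Suc k) = fps_X * term_fps (Suc k) + fps_X\<^sup>2 * (1 + fps_X)\<^sup>2 * term_fps k"
proof -
  have "term_fps (Suc k) =
      (fps_X * diag_fps (Suc k) + fps_X\<^sup>2 * diag_fps k) * (1 + fps_X) ^ (2 * Suc k)"
    using diag_fps_Suc by (simp add: term_fps_def)
  also have "\<dots> = fps_X * term_fps (Suc k) + fps_X\<^sup>2 * (1 + fps_X)\<^sup>2 * term_fps k"
    by (simp add: term_fps_def distrib_right power_add ac_simps power2_eq_square)
  finally show ?thesis .
qed

text \<open>A Cauchy product. Its summands with \<open>j > m - 2 * k\<close> vanish because then
  \<open>m - k - j < k\<close>.\<close>

lemma term_fps_nth:
  "term_fps k $ m = (\<Sum>j=0..m - 2 * k. ((m - k - j) choose k) * ((2 * k) choose j))"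
proof -
  have "term_fps k $ m = (\<Sum>j=0..m. ((m - j - k) choose k) * ((2 * k) choose j))"
    unfolding term_fps_def
    by (subst mult.commute, subst fps_mult_nth)
       (simp add: one_plus_X_power_nth diag_fps_def mult.commute)
  also have "\<dots> = (\<Sum>j=0..m. ((m - k - j) choose k) * ((2 * k) choose j))"
    by (simp only: diff_commute)
  also have "\<dots> = (\<Sum>j=0..m - 2 * k. ((m - k - j) choose k) * ((2 * k) choose j))"
  proof (rule sum.mono_neutral_right)
    show "\<forall>j\<in>{0..m} - {0..m - 2 * k}. (m - k - j choose k) * (2 * k choose j) = 0"
    proof
      fix j assume "j \<in> {0..m} - {0..m - 2 * k}"
      then have "m - k - j < k \<or> 2 * k < j" by auto
      then show "(m - k - j choose k) * (2 * k choose j) = 0" by auto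
    qed
  qed auto
  finally show ?thesis .
qed

text \<open>The range collapses to \<open>j = 0\<close>, where \<open>m - k < k\<close> makes the
  binomial vanish. Hence finite partial sums suffice.\<close>

lemma term_fps_nth_eq_0:
  assumes "m < 2 * k"
  shows "term_fps k $ m = 0"
  using assms by (simp add: term_fps_nth)

text \<open>A finite version of \<open>F = 1 + x F + x^2 (1 + x)^2 F\<close>; the last sum stops one
  term earlier.\<close>

lemma sum_term_fps:
  "(\<Sum>k\<le>Suc N. term_fps k) = 1 + fps_X * (\<Sum>k\<le>Suc N. term_fps k)
     + fps_X\<^sup>2 * (1 + fps_X)\<^sup>2 * (\<Sum>k\<le>N. term_fps k)"
proof -
  have "(\<Sum>k\<le>Suc N. term_fps k) = term_fps 0 + (\<Sum>k\<le>N. term_fps (Suc k))"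
    by (rule sum.atMost_Suc_shift)
  also have "(\<Sum>k\<le>N. term_fps (Suc k)) =
      (\<Sum>k\<le>N. fps_X * term_fps (Suc k) + fps_X\<^sup>2 * (1 + fps_X)\<^sup>2 * term_fps k)"
    by (intro sum.cong refl term_fps_Suc)
  also have "\<dots> = fps_X * (\<Sum>k\<le>N. term_fps (Suc k))
      + fps_X\<^sup>2 * (1 + fps_X)\<^sup>2 * (\<Sum>k\<le>N. term_fps k)"
    by (simp only: sum.distrib sum_distrib_left)
  also have "term_fps 0 + \<dots> = 1 + fps_X * (term_fps 0 + (\<Sum>k\<le>N. term_fps (Suc k)))
      + fps_X\<^sup>2 * (1 + fps_X)\<^sup>2 * (\<Sum>k\<le>N. term_fps k)"
    by (subst term_fps_0) (simp only: distrib_left ac_simps)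
  also have "term_fps 0 + (\<Sum>k\<le>N. term_fps (Suc k)) = (\<Sum>k\<le>Suc N. term_fps k)"
    by (rule sum.atMost_Suc_shift[symmetric])
  finally show ?thesis .
qed

lemma closed_form_eq_nth:
  assumes "m \<le> 2 * N"
  shows "closed_form m = (\<Sum>k\<le>N. term_fps k) $ m"
proof -
  have "(\<Sum>k\<le>N. term_fps k) $ m = (\<Sum>k\<le>N. term_fps k $ m)"
    by (simp add: fps_sum_nth)
  also have "\<dots> = (\<Sum>k=0..m div 2. term_fps k $ m)"
    using assms by (intro sum.mono_neutral_right) (auto intro!: term_fps_nth_eq_0)
  finally show ?thesis by (simp add: closed_form_def term_fps_nth)
qed

text \<open>Coefficient \<open>m\<close> of the finite functional equation. The conditionals give 0
  where truncated subtraction would give \<open>closed_form 0 = 1\<close>.\<close>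

lemma closed_form_rec:
  assumes "m > 0"
  shows "closed_form m = closed_form (m - 1)
    + (if m \<ge> 2 then closed_form (m - 2) else 0)
    + 2 * (if m \<ge> 3 then closed_form (m - 3) else 0)
    + (if m \<ge> 4 then closed_form (m - 4) else 0)"
proof -
  let ?T = "\<lambda>N. \<Sum>k\<le>N. term_fps k"
  have "closed_form m = ?T (Suc m) $ m" by (rule closed_form_eq_nth) simp
  also have "\<dots> = (1 + fps_X * ?T (Suc m) + fps_X\<^sup>2 * (1 + fps_X)\<^sup>2 * ?T m) $ m"
    by (subst sum_term_fps) (rule refl)
  \<comment> \<open>The coefficients 1, 2, 1 of this polynomial are those of the recurrence at
    distances 2, 3, 4.\<close>
  also have "fps_X\<^sup>2 * (1 + fps_X)\<^sup>2 = (fps_X\<^sup>2 + (fps_X ^ 3 + fps_X ^ 3) + fps_X ^ 4 :: nat fps)"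
    by (simp add: power2_eq_square distrib_left distrib_right eval_nat_numeral ac_simps)
  also have "(1 + fps_X * ?T (Suc m) + \<dots> * ?T m) $ m =
    ?T (Suc m) $ (m - 1) + (if m \<ge> 2 then ?T m $ (m - 2) else 0)
    + 2 * (if m \<ge> 3 then ?T m $ (m - 3) else 0) + (if m \<ge> 4 then ?T m $ (m - 4) else 0)"
    using assms by (simp add: distrib_right fps_X_power_mult_nth del: sum.atMost_Suc)
  also have "?T (Suc m) $ (m - 1) = closed_form (m - 1)"
    by (rule closed_form_eq_nth[symmetric]) simp
  also have "?T m $ (m - 2) = closed_form (m - 2)"
    by (rule closed_form_eq_nth[symmetric]) simp
  also have "?T m $ (m - 3) = closed_form (m - 3)"
    by (rule closed_form_eq_nth[symmetric]) simp
  also have "?T m $ (m - 4) = closed_form (m - 4)"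
    by (rule closed_form_eq_nth[symmetric]) simp
  finally show ?thesis .
qed

lemma closed_form_0: "closed_form 0 = 1"
  by (simp add: closed_form_def)

unbundle no fps_syntax

text \<open>Both sides agree at \<open>n = 2\<close> and obey the same recurrence; the empty sets
  for lengths below 2 match the zero branches in \<open>closed_form_rec\<close>.\<close>

lemma card_cycle_lists_closed_form: "2 \<le> n \<Longrightarrow> card (cycle_lists n) = closed_form (n - 2)"
proof (induction n rule: less_induct)
  case (less n)
  show ?case
  proof (cases "n = 2")
    case True
    then show ?thesis using card_cycle_lists_2 closed_form_0 by simp
  next
    case False
    then have n: "3 \<le> n" using less.prems by simp
    have IH: "card (cycle_lists (n - i)) = (if i \<le> n - 2 then closed_form (n - 2 - i) else 0)"
      if "0 < i" for i
      using less.IH[of "n - i"] card_cycle_lists_less_2[of "n - i"] n that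
      by (auto simp: diff_commute)
    have IH1: "card (cycle_lists (n - 1)) = closed_form (n - 2 - 1)"
      using less.IH[of "n - 1"] n by (simp add: numeral_3_eq_3)
    have "0 < n - 2" using n by simp
    note closed = closed_form_rec[OF this]
    show ?thesis
      unfolding card_cycle_lists_rec[OF n] closed IH1 IH[of 2, simplified] IH[of 3, simplified]
        IH[of 4, simplified] by simp
  qed
qed

theorem theorem6p18:
  defines "a \<equiv> \<lambda>n::nat. num_avoiders n [3,1,2] [3,2,1]"
  shows "(\<forall>n\<ge>7. a n = a (n - 1) + a (n - 2) + 2 * a (n - 3) + a (n - 4)) \<and>
    a 3 = 1 \<and> a 4 = 2 \<and> a 5 = 5 \<and> a 6 = 10 \<and>
    (\<forall>n\<ge>3. a n =
       (\<Sum>k=0..(n - 2) div 2. \<Sum>j=0..n - 2 - 2 * k.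
          ((n - 2 - k - j) choose k) * ((2 * k) choose j)))"
proof -
  have a: "a n = card (cycle_lists n)" if "2 \<le> n" for n
    using num_avoiders_eq_card_cycle_lists[OF that] by (simp only: a_def)
  have c3: "card (cycle_lists 3) = 1" and c4: "card (cycle_lists 4) = 2"
    and c5: "card (cycle_lists 5) = 5" and c6: "card (cycle_lists 6) = 10"
    by (simp_all add: card_cycle_lists_rec card_cycle_lists_less_2 card_cycle_lists_2)
  \<comment> \<open>All arguments are at least 3 here, so \<open>a\<close> agrees with the
    cardinality of \<open>cycle_lists\<close> at each of them.\<close>
  have "a n = a (n - 1) + a (n - 2) + 2 * a (n - 3) + a (n - 4)" if "7 \<le> n" for n
    using that card_cycle_lists_rec[of n] by (simp add: a)
  moreover have "a n = closed_form (n - 2)" if "3 \<le> n" for n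
    using that card_cycle_lists_closed_form[of n] by (simp add: a)
  ultimately show ?thesis
    using c3 c4 c5 c6 by (simp add: a closed_form_def)
qed

end
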